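(* Let $m,n$ be nonnegative integers. Then, as formal power series in $x$, $$\frac{(2-x)^n}{(1-x)^{m+n+1}}=\sum_{k=0}^\infty\binom{m+k,\,n}{k}x^k.$$
   Context: For nonnegative integers $m,n,k$, let $X$ be a set that is the disjoint union of blocks $X_1,\dots,X_n,Y$ with $|X_i|=2$ for $i=1,\dots,n$ and $|Y|=m$. The number $\binom{m,n}{k}$ is defined as the number of $(n+k)$-element subsets of $X$ that intersect each block $X_i$, $i=1,\dots,n$ (such subsets are called $(n+k)$-insets of $X$). *)

theory Defs
  imports
    "HOL-Computational_Algebra.Formal_Power_Series"
    "HOL-Library.Disjoint_Sets"
begin

definition block_system :: "nat \<Rightarrow> nat \<Rightarrow> (nat \<Rightarrow> 'a set) \<Rightarrow> 'a set \<Rightarrow> bool" where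
  "block_system m n X Y \<longleftrightarrow>
     disjoint_family_on X {1..n} \<and>
     (\<forall>i\<in>{1..n}. X i \<inter> Y = {}) \<and>
     (\<forall>i\<in>{1..n}. card (X i) = 2) \<and>
     finite Y \<and> card Y = m"

definition insets :: "nat \<Rightarrow> nat \<Rightarrow> (nat \<Rightarrow> 'a set) \<Rightarrow> 'a set \<Rightarrow> 'a set set" where
  "insets n k X Y =
     {S. S \<subseteq> (\<Union>i\<in>{1..n}. X i) \<union> Y \<and> card S = n + k \<and> (\<forall>i\<in>{1..n}. S \<inter> X i \<noteq> {})}"

text \<open>
  The number of insets is counted in one fixed model of the blocks; by \<open>card_insets\<close> below
  every other choice of blocks gives the same number.
\<close>

definition std_block :: "nat \<Rightarrow> (nat \<times> bool + nat) set" where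
  "std_block i = {Inl (i, False), Inl (i, True)}"

definition std_rest :: "nat \<Rightarrow> (nat \<times> bool + nat) set" where
  "std_rest m = Inr ` {1..m}"

definition inset_number :: "nat \<Rightarrow> nat \<Rightarrow> nat \<Rightarrow> nat" where
  "inset_number m n k = card (insets n k std_block (std_rest m))"

lemma block_system_std: "block_system m n std_block (std_rest m)"
  by (auto simp: block_system_def std_block_def std_rest_def disjoint_family_on_def card_image)

lemma card_insets_eq:
  fixes X :: "nat \<Rightarrow> 'a set" and X' :: "nat \<Rightarrow> 'b set"
  assumes B: "block_system m n X Y" and B': "block_system m n X' Y'"
  shows "card (insets n k X Y) = card (insets n k X' Y')"
proof -
  define Z where "Z = (\<lambda>i. if i = 0 then Y else X i)"
  define Z' where "Z' = (\<lambda>i. if i = 0 then Y' else X' i)"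
  note One_nat_def [simp del]
  have ivl: "{0..n} = insert 0 {1..n}" by auto
  have Un: "(\<Union>i\<in>{1..n}. X i) \<union> Y = (\<Union>i\<in>{0..n}. Z i)"
    unfolding ivl by (auto simp: Z_def)
  have Un': "(\<Union>i\<in>{1..n}. X' i) \<union> Y' = (\<Union>i\<in>{0..n}. Z' i)"
    unfolding ivl by (auto simp: Z'_def)
  have disj: "disjoint_family_on Z {0..n}"
    using B by (fastforce simp: block_system_def disjoint_family_on_def Z_def)
  have disj': "disjoint_family_on Z' {0..n}"
    using B' by (fastforce simp: block_system_def disjoint_family_on_def Z'_def)
  have "\<exists>f. bij_betw f (Z i) (Z' i)" if "i \<in> {0..n}" for i
  proof (rule finite_same_card_bij)
    show "finite (Z i)" "finite (Z' i)" "card (Z i) = card (Z' i)"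
      using B B' that by (auto simp: block_system_def Z_def Z'_def intro: card_ge_0_finite)
  qed
  then obtain g where g: "\<And>i. i \<in> {0..n} \<Longrightarrow> bij_betw (g i) (Z i) (Z' i)"
    by metis
  define h where "h = (\<lambda>x. g (THE i. i \<in> {0..n} \<and> x \<in> Z i) x)"
  have h_eq: "h x = g i x" if "i \<in> {0..n}" "x \<in> Z i" for i x
  proof -
    have "(THE i. i \<in> {0..n} \<and> x \<in> Z i) = i"
    proof (rule the_equality)
      show "i \<in> {0..n} \<and> x \<in> Z i" using that by simp
      show "j = i" if "j \<in> {0..n} \<and> x \<in> Z j" for j
        using that disj \<open>i \<in> {0..n}\<close> \<open>x \<in> Z i\<close> unfolding disjoint_family_on_def by blast
    qed
    then show ?thesis by (simp add: h_def)
  qed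
  have hZ: "bij_betw h (Z i) (Z' i)" if "i \<in> {0..n}" for i
    using g[OF that] h_eq[OF that] by (simp cong: bij_betw_cong)
  let ?U = "\<Union>i\<in>{0..n}. Z i" and ?U' = "\<Union>i\<in>{0..n}. Z' i"
  have h: "bij_betw h ?U ?U'"
    by (rule bij_betw_UNION_disjoint[OF disj']) (use hZ in auto)
  have meet: "h ` S \<inter> X' i \<noteq> {} \<longleftrightarrow> S \<inter> X i \<noteq> {}" if i: "i \<in> {1..n}" and S: "S \<subseteq> ?U" for i S
  proof -
    have "h ` Z i = Z' i" "Z i \<subseteq> ?U"
      using hZ[of i] i by (auto simp: bij_betw_def)
    then have "h ` (S \<inter> Z i) = h ` S \<inter> Z' i"
      using inj_on_image_Int[OF bij_betw_imp_inj_on[OF h] S, of "Z i"] by simp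
    then show ?thesis using i by (auto simp: Z_def Z'_def)
  qed
  have crd: "card (h ` S) = card S" if "S \<subseteq> ?U" for S
    using that h by (meson bij_betw_imp_inj_on card_image inj_on_subset)
  have "bij_betw (image h) (insets n k X Y) (insets n k X' Y')"
  proof (rule bij_betw_imageI)
    have "inj_on (image h) (Pow ?U)"
      using bij_betw_Pow[OF h] by (rule bij_betw_imp_inj_on)
    then show "inj_on (image h) (insets n k X Y)"
      by (rule inj_on_subset) (unfold insets_def Un, blast)
    show "image h ` insets n k X Y = insets n k X' Y'"
    proof (intro equalityI subsetI)
      fix T assume "T \<in> image h ` insets n k X Y"
      then obtain S where S: "S \<in> insets n k X Y" and T: "T = h ` S" by blast
      from S have sub: "S \<subseteq> ?U" unfolding insets_def Un by blast
      have "T \<subseteq> ?U'" unfolding T using image_mono[OF sub] bij_betw_imp_surj_on[OF h] by metis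
      then show "T \<in> insets n k X' Y'"
        using S meet[OF _ sub] crd[OF sub] by (simp add: insets_def Un' T)
    next
      fix T assume T: "T \<in> insets n k X' Y'"
      then have "T \<subseteq> h ` ?U"
        unfolding bij_betw_imp_surj_on[OF h] insets_def Un' by blast
      then obtain S where sub: "S \<subseteq> ?U" and TS: "T = h ` S" by (auto simp: subset_image_iff)
      have "S \<in> insets n k X Y"
        using T meet[OF _ sub] crd[OF sub] sub by (simp add: insets_def Un TS)
      then show "T \<in> image h ` insets n k X Y" using TS by blast
    qed
  qed
  then show ?thesis by (rule bij_betw_same_card)
qed

lemma card_insets:
  assumes "block_system m n X Y"
  shows "card (insets n k X Y) = inset_number m n k"
  unfolding inset_number_def by (rule card_insets_eq[OF assms block_system_std])

end

theory Submission
  imports Defs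
begin

text \<open>
  Both sides, as functions of \<open>n\<close>, satisfy the same recurrence. Split the insets for \<open>n + 1\<close>
  blocks according to their trace on the last block, a pair \<open>{a, b}\<close>: the trace is \<open>{a}\<close> or
  \<open>{b}\<close>, and the rest is an \<open>(n+k)\<close>-inset, or it is \<open>{a, b}\<close>, and the rest is an
  \<open>(n+k-1)\<close>-inset. Hence
  \[ \binom{m, n+1}{k} = 2 \binom{m, n}{k} + \binom{m, n}{k-1} , \]
  where the last term vanishes for \<open>k = 0\<close>, because an inset has at least one element in each of
  the disjoint blocks (\<open>inset_number_Suc_0\<close>, \<open>inset_number_Suc_Suc\<close>).

  Let \<open>F\<^sub>m\<^sub>,\<^sub>n\<close> (\<open>inset_fps m n\<close>) be the power series whose coefficient at \<open>x\<^sup>k\<close> is the inset number with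
  parameters \<open>m + k\<close>, \<open>n\<close>, \<open>k\<close>. As \<open>k\<close> decreases by one in the last term while \<open>m + k\<close> stays, that
  term belongs to the series for \<open>m + 1\<close>, and the recurrence becomes
  \<open>F\<^sub>m\<^sub>,\<^sub>n\<^sub>+\<^sub>1 = 2 F\<^sub>m\<^sub>,\<^sub>n + x F\<^sub>m\<^sub>+\<^sub>1\<^sub>,\<^sub>n\<close>. The claimed closed form obeys it since
  \<open>2 + x / (1 - x) = (2 - x) / (1 - x)\<close>, and for \<open>n = 0\<close> it is the expansion of
  \<open>1 / (1 - x)\<^sup>m\<^sup>+\<^sup>1\<close> into binomial coefficients.
\<close>

lemma finite_Union_block_system:
  assumes "block_system m n X Y"
  shows "finite ((\<Union>i\<in>{1..n}. X i) \<union> Y)"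
  using assms by (auto simp: block_system_def intro: card_ge_0_finite)

lemma finite_insets:
  assumes "block_system m n X Y"
  shows "finite (insets n k X Y)"
proof (rule finite_subset)
  show "insets n k X Y \<subseteq> Pow ((\<Union>i\<in>{1..n}. X i) \<union> Y)"
    unfolding insets_def by blast
  show "finite (Pow ((\<Union>i\<in>{1..n}. X i) \<union> Y))"
    using finite_Union_block_system[OF assms] by simp
qed

lemma card_ge_if_meets_disjoint_family:
  assumes disj: "disjoint_family_on X I" and meets: "\<And>i. i \<in> I \<Longrightarrow> S \<inter> X i \<noteq> {}"
    and fin: "finite S"
  shows "card I \<le> card S"
proof -
  have "\<forall>i\<in>I. \<exists>x. x \<in> S \<inter> X i"
    using meets by blast
  then obtain f where f: "\<And>i. i \<in> I \<Longrightarrow> f i \<in> S \<inter> X i"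
    by metis
  have "inj_on f I"
    using f disj by (fastforce simp: inj_on_def disjoint_family_on_def)
  then show ?thesis
    using f fin by (intro card_inj_on_le) auto
qed

lemma block_system_Suc:
  assumes B: "block_system m (Suc n) X Y"
  obtains a b where "X (Suc n) = {a, b}" "a \<noteq> b"
    "a \<notin> (\<Union>i\<in>{1..n}. X i) \<union> Y" "b \<notin> (\<Union>i\<in>{1..n}. X i) \<union> Y" "block_system m n X Y"
proof -
  have "card (X (Suc n)) = 2"
    using B by (simp add: block_system_def)
  then obtain a b where ab: "X (Suc n) = {a, b}" "a \<noteq> b"
    by (auto simp: card_2_iff)
  have "X i \<inter> X (Suc n) = {}" if "i \<in> {1..n}" for i
    using B that by (auto simp: block_system_def disjoint_family_on_def)
  moreover have "X (Suc n) \<inter> Y = {}" "block_system m n X Y"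
    using B by (auto simp: block_system_def disjoint_family_on_def)
  ultimately show thesis
    using that ab by auto
qed

text \<open>
  The three sets on the right correspond to the traces \<open>{a}\<close>, \<open>{b}\<close> and \<open>{a, b}\<close> on the last
  block. The third one is not written with \<^const>\<open>insets\<close>, since its cardinality condition for
  \<open>k = 0\<close> would need the parameter \<open>-1\<close>.
\<close>

lemma insets_Suc_eq:
  assumes ab: "X (Suc n) = {a, b}" "a \<noteq> b"
    and new: "a \<notin> (\<Union>i\<in>{1..n}. X i) \<union> Y" "b \<notin> (\<Union>i\<in>{1..n}. X i) \<union> Y"
    and fin: "finite ((\<Union>i\<in>{1..n}. X i) \<union> Y)"
  shows "insets (Suc n) k X Y =
    insert a ` insets n k X Y \<union> insert b ` insets n k X Y \<union>
    (\<lambda>T. insert a (insert b T)) `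
      {T. T \<subseteq> (\<Union>i\<in>{1..n}. X i) \<union> Y \<and> Suc (card T) = n + k \<and> (\<forall>i\<in>{1..n}. T \<inter> X i \<noteq> {})}"
    (is "_ = ?A \<union> ?B \<union> ?C")
proof -
  let ?U = "(\<Union>i\<in>{1..n}. X i) \<union> Y"
  have ivl: "{1..Suc n} = insert (Suc n) {1..n}" by auto
  have finT: "finite T" if "T \<subseteq> ?U" for T
    using that fin by (rule finite_subset)
  have notin: "a \<notin> T" "b \<notin> T" if "T \<subseteq> ?U" for T
    using that new by auto
  show ?thesis
  proof (intro equalityI subsetI)
    fix S assume S: "S \<in> insets (Suc n) k X Y"
    define T where "T = S - {a, b}"
    have T: "T \<subseteq> ?U" and crd: "card S = Suc (n + k)" and hit: "a \<in> S \<or> b \<in> S"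
      using S ab unfolding insets_def ivl T_def by auto
    have TX: "\<forall>i\<in>{1..n}. T \<inter> X i \<noteq> {}"
    proof
      fix i assume i: "i \<in> {1..n}"
      then have "S \<inter> X i \<noteq> {}" using S unfolding insets_def ivl by auto
      moreover have "a \<notin> X i" "b \<notin> X i" using i new by auto
      ultimately show "T \<inter> X i \<noteq> {}" unfolding T_def by blast
    qed
    consider "S = insert a T" | "S = insert b T" | "S = insert a (insert b T)"
      using hit unfolding T_def by blast
    then show "S \<in> ?A \<union> ?B \<union> ?C"
    proof cases
      case 1
      then have "T \<in> insets n k X Y"
        using T TX crd notin[OF T] finT[OF T] by (simp add: insets_def)
      then show ?thesis using 1 by blast
    next
      case 2
      then have "T \<in> insets n k X Y"
        using T TX crd notin[OF T] finT[OF T] by (simp add: insets_def)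
      then show ?thesis using 2 by blast
    next
      case 3
      then have "Suc (card T) = n + k"
        using crd notin[OF T] finT[OF T] ab by simp
      then show ?thesis using 3 T TX by blast
    qed
  next
    fix S assume "S \<in> ?A \<union> ?B \<union> ?C"
    then obtain T where T: "T \<subseteq> ?U" and TX: "\<forall>i\<in>{1..n}. T \<inter> X i \<noteq> {}"
      and cases: "S = insert a T \<and> card T = n + k \<or> S = insert b T \<and> card T = n + k \<or>
        S = insert a (insert b T) \<and> Suc (card T) = n + k"
      unfolding insets_def by blast
    have "card S = Suc n + k"
      using cases notin[OF T] finT[OF T] ab by auto
    moreover have "S \<subseteq> (\<Union>i\<in>{1..Suc n}. X i) \<union> Y"
      using cases T ab unfolding ivl by auto
    moreover have "\<forall>i\<in>{1..Suc n}. S \<inter> X i \<noteq> {}"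
      using cases TX ab unfolding ivl by fastforce
    ultimately show "S \<in> insets (Suc n) k X Y"
      by (simp add: insets_def)
  qed
qed

lemma card_insets_Suc:
  assumes B: "block_system m (Suc n) X Y"
  shows "card (insets (Suc n) k X Y) = 2 * card (insets n k X Y) +
    card {T. T \<subseteq> (\<Union>i\<in>{1..n}. X i) \<union> Y \<and> Suc (card T) = n + k \<and> (\<forall>i\<in>{1..n}. T \<inter> X i \<noteq> {})}"
    (is "_ = _ + card ?D")
proof -
  obtain a b where ab: "X (Suc n) = {a, b}" "a \<noteq> b"
    and new: "a \<notin> (\<Union>i\<in>{1..n}. X i) \<union> Y" "b \<notin> (\<Union>i\<in>{1..n}. X i) \<union> Y"
    and B': "block_system m n X Y"
    by (rule block_system_Suc[OF B])
  let ?ab = "\<lambda>T. insert a (insert b T)"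
  define I where "I = insets n k X Y"
  define D where "D = ?D"
  have notin: "a \<notin> T \<and> b \<notin> T" if "T \<in> I \<or> T \<in> D" for T
    using that new unfolding I_def D_def insets_def by blast
  have fin: "finite I" "finite D"
    using finite_insets[OF B'] finite_Union_block_system[OF B'] by (simp_all add: I_def D_def)
  have "inj_on (insert a) I"
    using notin by (intro inj_on_inverseI[where g = "\<lambda>T. T - {a}"]) simp
  moreover have "inj_on (insert b) I"
    using notin by (intro inj_on_inverseI[where g = "\<lambda>T. T - {b}"]) simp
  moreover have "inj_on ?ab D"
    using notin by (intro inj_on_inverseI[where g = "\<lambda>T. T - {a, b}"]) auto
  ultimately have card: "card (insert a ` I) = card I" "card (insert b ` I) = card I"
    "card (?ab ` D) = card D"
    by (simp_all only: card_image)
  have "a \<in> S \<and> b \<notin> S" if "S \<in> insert a ` I" for S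
    using that notin ab(2) by auto
  moreover have "a \<notin> S \<and> b \<in> S" if "S \<in> insert b ` I" for S
    using that notin ab(2) by auto
  moreover have "a \<in> S \<and> b \<in> S" if "S \<in> ?ab ` D" for S
    using that by auto
  ultimately have "insert a ` I \<inter> insert b ` I = {}"
    "(insert a ` I \<union> insert b ` I) \<inter> ?ab ` D = {}"
    by (meson disjoint_iff UnE)+
  moreover have "insets (Suc n) k X Y = insert a ` I \<union> insert b ` I \<union> ?ab ` D"
    unfolding I_def D_def by (rule insets_Suc_eq[OF ab new finite_Union_block_system[OF B']])
  ultimately have "card (insets (Suc n) k X Y) = 2 * card I + card D"
    by (simp add: card_Un_disjoint fin card)
  then show ?thesis
    by (simp only: I_def D_def)
qed

text \<open>
  For \<open>k = 0\<close> no inset contains the last block: the rest would have only \<open>n - 1\<close> elements, too few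
  to meet \<open>n\<close> disjoint blocks.
\<close>

lemma inset_number_Suc_0: "inset_number m (Suc n) 0 = 2 * inset_number m n 0"
proof -
  let ?X = std_block and ?Y = "std_rest m"
  note B = block_system_std[of m n]
  have "Suc (card T) \<noteq> n + 0"
    if T: "T \<subseteq> (\<Union>i\<in>{1..n}. ?X i) \<union> ?Y" "\<forall>i\<in>{1..n}. T \<inter> ?X i \<noteq> {}" for T
  proof -
    have "card {1..n} \<le> card T"
      using B T finite_subset[OF T(1) finite_Union_block_system[OF B]]
      by (intro card_ge_if_meets_disjoint_family) (auto simp: block_system_def)
    then show ?thesis by simp
  qed
  then have "{T. T \<subseteq> (\<Union>i\<in>{1..n}. ?X i) \<union> ?Y \<and> Suc (card T) = n + 0 \<and>
      (\<forall>i\<in>{1..n}. T \<inter> ?X i \<noteq> {})} = {}"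
    by blast
  then show ?thesis
    unfolding inset_number_def card_insets_Suc[OF block_system_std] by (simp only: card.empty)
qed

lemma inset_number_Suc_Suc:
  "inset_number m (Suc n) (Suc k) = 2 * inset_number m n (Suc k) + inset_number m n k"
  unfolding inset_number_def card_insets_Suc[OF block_system_std]
  by (simp add: insets_def)

lemma inset_number_0: "inset_number m 0 k = m choose k"
  using n_subsets[of "std_rest m" k] block_system_std[of m 0]
  by (simp add: inset_number_def insets_def block_system_def)

definition inset_fps :: "nat \<Rightarrow> nat \<Rightarrow> 'a::field_char_0 fps" where
  "inset_fps m n = Abs_fps (\<lambda>k. of_nat (inset_number (m + k) n k))"

lemma inset_fps_0: "inset_fps m 0 = inverse ((1 - fps_X :: 'a::field_char_0 fps) ^ (m + 1))"
  using one_minus_const_fps_X_neg_power'[of "m + 1" "1 :: 'a"]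
  by (simp add: inset_fps_def inset_number_0 del: power_Suc)

lemma inset_fps_Suc: "inset_fps m (Suc n) = 2 * inset_fps m n + fps_X * inset_fps (Suc m) n"
proof (rule fps_ext)
  fix k
  show "fps_nth (inset_fps m (Suc n)) k =
      fps_nth (2 * inset_fps m n + fps_X * inset_fps (Suc m) n) k"
    by (cases k) (simp_all add: inset_fps_def inset_number_Suc_0 inset_number_Suc_Suc
        fps_numeral_fps_const)
qed

text \<open>
  Multiplied out, the closed form can be proved by ring identities alone. The induction is over
  all \<open>m\<close> at once, because the recurrence raises \<open>m\<close>.
\<close>

lemma inset_fps_times:
  "inset_fps m n * (1 - fps_X) ^ (m + n + 1) = (2 - fps_X :: 'a::field_char_0 fps) ^ n"
proof (induction n arbitrary: m)
  case 0
  show ?case by (simp add: inset_fps_0 inverse_mult_eq_1 del: power_Suc)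
next
  case (Suc n)
  let ?q = "1 - fps_X :: 'a fps"
  have "inset_fps m (Suc n) * ?q ^ (m + Suc n + 1) =
      2 * ?q * (inset_fps m n * ?q ^ (m + n + 1)) +
      fps_X * (inset_fps (Suc m) n * ?q ^ (Suc m + n + 1))"
    by (simp add: inset_fps_Suc algebra_simps)
  also have "\<dots> = (2 * ?q + fps_X) * (2 - fps_X) ^ n"
    unfolding Suc.IH by (simp add: algebra_simps)
  also have "2 * ?q + fps_X = 2 - fps_X"
    by (simp add: algebra_simps)
  finally show ?case by simp
qed

theorem proposition11:
  fixes m n :: nat
  shows "(2 - fps_X) ^ n / (1 - fps_X) ^ (m + n + 1) =
    (Abs_fps (\<lambda>k. of_nat (inset_number (m + k) n k)) :: 'a::field_char_0 fps)"
proof -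
  have "fps_nth ((1 - fps_X) ^ (m + n + 1) :: 'a fps) 0 \<noteq> 0"
    by (simp add: fps_nth_power_0)
  then have "(1 - fps_X) ^ (m + n + 1) \<noteq> (0 :: 'a fps)"
    by auto
  then show ?thesis
    unfolding inset_fps_times[of m n, symmetric] inset_fps_def[symmetric]
    by (rule nonzero_mult_div_cancel_right)
qed

end
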